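(* Let $f\colon[e,+\infty)\to\mathbb R$ ($e\in\mathbb R$) be a continuous function with hardian germ and $f(t)\ne0$ for all $t\ge e$. Let $y\colon[e,+\infty)\to\mathbb R$ be twice continuously differentiable and oscillating with $y''+fy=0$ on $[e,+\infty)$, and let $s_0<s_1<s_2<\cdots$ be the enumeration of $y^{-1}(0)$. Suppose $f\sim cx^{-2+r}$ with $c,r\in\mathbb R$, $c>0$, $r\ge0$. (i) If $r>0$, then $s_n\sim\big(r\pi n/(2\sqrt c)\big)^{2/r}$ as $n\to\infty$. (ii) If $r=0$ and the germ of $f$ is in $\mathbb R(x)$, then $c>\frac14$ and $\log s_n\sim\pi n/\sqrt{c-\tfrac14}$ as $n\to\infty$.
   Context: A Hardy field is a field of germs at $+\infty$ of real-valued functions, contained in the ring of germs that have for every $n$ an $n$-times continuously differentiable representative on some $[a,+\infty)$, and closed under differentiation. A germ is hardian if it lies in a Hardy field. $x$ is the germ of the identity function, and $\mathbb R(x)$ is the Hardy field of germs of rational functions. $g\sim h$ means $h(t)\neq0$ eventually and $g(t)/h(t)\to1$ as $t\to+\infty$. A function oscillates if it is $0$ at arbitrarily large $t$ and nonzero at arbitrarily large $t$. The set $y^{-1}(0)$ is closed, unbounded and without limit point, so it has an enumeration $s_0<s_1<\cdots$ with $s_n\to+\infty$. *)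

theory Defs
  imports
    "HOL-Analysis.Analysis"
    "HOL-Library.Landau_Symbols"
    "HOL-Computational_Algebra.Polynomial"
begin

text \<open>
  Germs at \<open>+\<infinity>\<close> of real-valued functions. A function on \<open>[a, +\<infinity>)\<close> is represented by any total
  function extending it; its germ does not depend on the extension.
\<close>

definition eventually_eq :: "(real \<Rightarrow> real) \<Rightarrow> (real \<Rightarrow> real) \<Rightarrow> bool" where
  "eventually_eq f g \<longleftrightarrow> (\<forall>\<^sub>F t in at_top. f t = g t)"

lemma equivp_eventually_eq: "equivp eventually_eq"
proof (rule equivpI)
  show "reflp eventually_eq"
    by (rule reflpI) (simp add: eventually_eq_def)
  show "symp eventually_eq"
    by (rule sympI) (simp add: eventually_eq_def eq_commute)
  show "transp eventually_eq"
    by (rule transpI, unfold eventually_eq_def, erule (1) eventually_elim2) simp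
qed

quotient_type germ = "real \<Rightarrow> real" / eventually_eq
  morphisms rep_germ germ_of
  by (rule equivp_eventually_eq)

instantiation germ :: comm_ring_1
begin

lift_definition zero_germ :: germ is "\<lambda>_. 0" .

lift_definition one_germ :: germ is "\<lambda>_. 1" .

lift_definition plus_germ :: "germ \<Rightarrow> germ \<Rightarrow> germ" is "\<lambda>f g t. f t + g t"
  unfolding eventually_eq_def by (erule (1) eventually_elim2) simp

lift_definition uminus_germ :: "germ \<Rightarrow> germ" is "\<lambda>f t. - f t"
  unfolding eventually_eq_def by (erule eventually_mono) simp

lift_definition minus_germ :: "germ \<Rightarrow> germ \<Rightarrow> germ" is "\<lambda>f g t. f t - g t"
  unfolding eventually_eq_def by (erule (1) eventually_elim2) simp

lift_definition times_germ :: "germ \<Rightarrow> germ \<Rightarrow> germ" is "\<lambda>f g t. f t * g t"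
  unfolding eventually_eq_def by (erule (1) eventually_elim2) simp

instance
  by standard (transfer, simp add: eventually_eq_def algebra_simps)+

end

text \<open>
  On germs with an eventually differentiable representative this is the usual derivation; on other
  germs the value is well defined but has no meaning.
\<close>

lift_definition germ_deriv :: "germ \<Rightarrow> germ" is "deriv :: (real \<Rightarrow> real) \<Rightarrow> real \<Rightarrow> real"
proof -
  fix f g :: "real \<Rightarrow> real"
  assume "eventually_eq f g"
  then obtain a where a: "\<And>t. t \<ge> a \<Longrightarrow> f t = g t"
    unfolding eventually_eq_def eventually_at_top_linorder by blast
  have "deriv f t = deriv g t" if "t > a" for t
  proof (rule deriv_cong_ev)
    have "\<forall>\<^sub>F u in nhds t. u \<in> {a<..}"
      using that by (intro eventually_nhds_in_open) auto
    then show "\<forall>\<^sub>F u in nhds t. f u = g u"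
      by (rule eventually_mono) (simp add: a)
  qed simp
  then show "eventually_eq (deriv f) (deriv g)"
    unfolding eventually_eq_def using eventually_gt_at_top[of a] by (rule eventually_mono[rotated])
qed

primrec times_cont_diff_on :: "nat \<Rightarrow> real set \<Rightarrow> (real \<Rightarrow> real) \<Rightarrow> bool" where
  "times_cont_diff_on 0 S f \<longleftrightarrow> continuous_on S f"
| "times_cont_diff_on (Suc n) S f \<longleftrightarrow>
     (\<exists>f'. (\<forall>t\<in>S. (f has_real_derivative f' t) (at t within S)) \<and> times_cont_diff_on n S f')"

definition smooth_germs :: "germ set" where
  "smooth_germs = {g. \<forall>n. \<exists>f a. g = germ_of f \<and> times_cont_diff_on n {a..} f}"

definition hardy_field :: "germ set \<Rightarrow> bool" where
  "hardy_field H \<longleftrightarrow>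
     H \<subseteq> smooth_germs \<and>
     0 \<in> H \<and> 1 \<in> H \<and>
     (\<forall>g\<in>H. \<forall>h\<in>H. g + h \<in> H) \<and>
     (\<forall>g\<in>H. - g \<in> H) \<and>
     (\<forall>g\<in>H. \<forall>h\<in>H. g * h \<in> H) \<and>
     (\<forall>g\<in>H. g \<noteq> 0 \<longrightarrow> (\<exists>h\<in>H. g * h = 1)) \<and>
     (\<forall>g\<in>H. germ_deriv g \<in> H)"

definition hardian :: "germ \<Rightarrow> bool" where
  "hardian g \<longleftrightarrow> (\<exists>H. hardy_field H \<and> g \<in> H)"

definition rational_germs :: "germ set" where
  "rational_germs = {germ_of (\<lambda>t. poly p t / poly q t) | p q :: real poly. q \<noteq> 0}"

definition oscillates :: "(real \<Rightarrow> real) \<Rightarrow> bool" where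
  "oscillates y \<longleftrightarrow> (\<exists>\<^sub>F t in at_top. y t = 0) \<and> (\<exists>\<^sub>F t in at_top. y t \<noteq> 0)"

text \<open>
  The relation \<open>g \<sim>[F] h\<close> of the library agrees with ``\<open>h\<close> is eventually nonzero and
  \<open>g / h\<close> tends to \<open>1\<close>'' whenever \<open>h\<close> is eventually nonzero.
\<close>

end

theory Submission
  imports Defs
begin

text \<open>
  The zeros of \<open>y\<close> are counted by comparing the equation with one that is solved in closed form.
  Put \<open>p = r / 2\<close>, and let \<open>L = power_log p\<close> be the primitive \<open>t\<^sup>p / p\<close> (or \<open>ln t\<close>, if \<open>p = 0\<close>) of
  \<open>t powr (p - 1)\<close>. The Liouville transformation turns the oscillation \<open>sin (b (L t - L a))\<close> into a
  solution \<open>t powr ((1 - p) / 2) * sin (b (L t - L a))\<close> of \<open>w'' + Q w = 0\<close>, where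
  \<open>Q t = b\<^sup>2 t powr (2 p - 2) + (1 - p\<^sup>2) / (4 t\<^sup>2)\<close>, and the zeros of this solution are
  spaced exactly \<open>pi / b\<close> apart on the scale of \<open>L\<close>.

  The first term of \<open>Q\<close> dominates if \<open>p > 0\<close>, and both terms have order \<open>t powr - 2\<close> if \<open>p = 0\<close>.
  Hence \<open>f\<close> is eventually below \<open>Q\<close> for every \<open>b > sqrt \<kappa>\<close> and above \<open>Q\<close> for every
  positive \<open>b < sqrt \<kappa>\<close>, where \<open>\<kappa> = c\<close> for \<open>r > 0\<close> and \<open>\<kappa> = c - 1 / 4\<close> for \<open>r = 0\<close>.
  Sturm comparison (\<open>sturm_comparison\<close>) on each gap between consecutive zeros then squeezes
  \<open>L (s (Suc n)) - L (s n)\<close> towards \<open>pi / sqrt \<kappa>\<close> (\<open>spacing_tendsto\<close>). Summing the gaps gives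
  \<open>L (s n) \<sim> pi * n / sqrt \<kappa>\<close>, and inverting \<open>L\<close> gives the claim for \<open>r > 0\<close>; for \<open>r = 0\<close> it is
  the claim already.

  For \<open>r = 0\<close> it remains to see that \<open>c > 1 / 4\<close>. If \<open>c \<le> 1 / 4\<close> and \<open>f\<close> is rational, then
  \<open>t\<^sup>2 f t - 1 / 4\<close> is eventually negative or is a rational function that vanishes at infinity, so it is
  at most \<open>K / t\<close> for some \<open>K\<close> (\<open>rational_le_critical\<close>). An equation with
  \<open>f t \<le> 1 / (4 t\<^sup>2) + K / t\<^sup>3\<close> has the positive strict supersolution \<open>sqrt t - K / sqrt t\<close> for large
  \<open>t\<close>, and Sturm comparison with it forbids two zeros (\<open>not_below_critical\<close>), so that \<open>y\<close> could not
  oscillate.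
\<close>

section \<open>The model equation\<close>

definition power_log :: "real \<Rightarrow> real \<Rightarrow> real" where
  "power_log p t = (if p = 0 then ln t else t powr p / p)"

text \<open>
  The second term is half the Schwarzian derivative of the phase \<open>b * power_log p t\<close>, the first the
  square of the derivative of the phase.
\<close>
definition model_coeff :: "real \<Rightarrow> real \<Rightarrow> real \<Rightarrow> real" where
  "model_coeff p b t = b\<^sup>2 * t powr (2 * p - 2) + (1 - p\<^sup>2) / 4 * t powr - 2"

definition model_sol :: "real \<Rightarrow> real \<Rightarrow> real \<Rightarrow> real \<Rightarrow> real" where
  "model_sol p b a t = t powr ((1 - p) / 2) * sin (b * (power_log p t - power_log p a))"

definition model_sol' :: "real \<Rightarrow> real \<Rightarrow> real \<Rightarrow> real \<Rightarrow> real" where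
  "model_sol' p b a t =
     (1 - p) / 2 * t powr ((- 1 - p) / 2) * sin (b * (power_log p t - power_log p a))
     + b * t powr ((p - 1) / 2) * cos (b * (power_log p t - power_log p a))"

lemma DERIV_power_log:
  assumes "t > 0"
  shows "(power_log p has_real_derivative t powr (p - 1)) (at t)"
proof (cases "p = 0")
  case True
  have "(ln has_real_derivative t powr (p - 1)) (at t)"
    using assms True by (auto intro!: derivative_eq_intros simp: powr_minus divide_inverse)
  moreover have "power_log p = ln" using True by (auto simp: power_log_def)
  ultimately show ?thesis by simp
next
  case False
  have "((\<lambda>t. t powr p / p) has_real_derivative p * t powr (p - 1) / p) (at t)"
    by (intro DERIV_cdivide has_real_derivative_powr assms)
  moreover have "power_log p = (\<lambda>t. t powr p / p)" using False by (auto simp: power_log_def)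
  ultimately show ?thesis using False by simp
qed

lemma power_log_strict_mono:
  assumes "0 < a" "a < b"
  shows "power_log p a < power_log p b"
proof (rule DERIV_pos_imp_increasing[OF assms(2)])
  fix x assume "a \<le> x"
  then show "\<exists>y. (power_log p has_real_derivative y) (at x) \<and> 0 < y"
    using assms DERIV_power_log[of x p] by (intro exI[of _ "x powr (p - 1)"]) auto
qed

lemma DERIV_model_sol:
  assumes "t > 0"
  shows "(model_sol p b a has_real_derivative model_sol' p b a t) (at t)"
proof -
  have exponents: "(- 1 - p) / 2 = (1 - p) / 2 - 1" "(p - 1) / 2 = (1 - p) / 2 + (p - 1)"
    by (simp_all add: field_simps)
  show ?thesis
    unfolding model_sol_def [abs_def] model_sol'_def exponents(1) unfolding exponents(2) powr_add
    using assms by (auto intro!: derivative_eq_intros DERIV_power_log[THEN DERIV_chain2] has_real_derivative_powr)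
qed

text \<open>
  The amplitude of \<open>model_sol\<close> is, up to a constant, the inverse square root of the derivative of the
  phase. This is the choice that makes the cosine terms of the second derivative cancel, so that it is a
  multiple of the function itself.
\<close>
lemma DERIV_model_sol':
  assumes "t > 0"
  shows "(model_sol' p b a has_real_derivative - model_coeff p b t * model_sol p b a t) (at t)"
proof -
  define \<theta> where "\<theta> t = b * (power_log p t - power_log p a)" for t
  define q where "q = (1 - p) / 2"
  have p: "p = 1 - 2 * q" by (simp add: q_def field_simps)
  have \<theta>': "(\<theta> has_real_derivative b * t powr (- 2 * q)) (at t)"
    unfolding \<theta>_def[abs_def] using DERIV_power_log[OF assms, of p]
    by (intro DERIV_cmult) (auto intro!: derivative_eq_intros simp: p)
  have deriv: "((\<lambda>t. q * t powr (q - 1) * sin (\<theta> t) + b * t powr (- q) * cos (\<theta> t)) has_real_derivative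
      q * ((q - 1) * t powr (q - 1 - 1)) * sin (\<theta> t) + q * t powr (q - 1) * (cos (\<theta> t) * (b * t powr (- 2 * q)))
      + (b * (- q * t powr (- q - 1)) * cos (\<theta> t) - b * t powr (- q) * (sin (\<theta> t) * (b * t powr (- 2 * q))))) (at t)"
    using assms by (auto intro!: derivative_eq_intros \<theta>' has_real_derivative_powr)
  have powers: "t powr (q - 1) * t powr (- 2 * q) = t powr (- q - 1)"
      "t powr (- q) * t powr (- 2 * q) = t powr (- 4 * q) * t powr q"
      "t powr (q - 1 - 1) = t powr - 2 * t powr q"
    by (simp_all flip: powr_add)
  (* The algebra of the second derivative, with the powers of t abstracted to variables:
     the two terms with C = cos cancel by the first relation between the powers. *)
  have collect: "q * ((q - 1) * R) * S + q * X * (C * (b * Y)) + (b * (- q * Z) * C - b * V * (S * (b * Y)))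
      = - (b\<^sup>2 * U + q * (1 - q) * N) * (T * S)"
    if "X * Y = Z" "V * Y = U * T" "R = N * T" for R S X C Y Z V U N T :: real
  proof -
    have "q * ((q - 1) * R) * S + q * X * (C * (b * Y)) + (b * (- q * Z) * C - b * V * (S * (b * Y)))
      = q * (q - 1) * R * S + q * b * C * (X * Y) - q * b * C * Z - b\<^sup>2 * S * (V * Y)"
      by (simp add: algebra_simps power2_eq_square)
    then show ?thesis unfolding that by (simp add: algebra_simps)
  qed
  have "((\<lambda>t. q * t powr (q - 1) * sin (\<theta> t) + b * t powr (- q) * cos (\<theta> t)) has_real_derivative
      - (b\<^sup>2 * t powr (- 4 * q) + q * (1 - q) * t powr - 2) * (t powr q * sin (\<theta> t))) (at t)"
    by (rule DERIV_cong[OF deriv collect[OF powers]])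
  moreover have exponents: "2 * p - 2 = - 4 * q" "(1 - p\<^sup>2) / 4 = q * (1 - q)" "(- 1 - p) / 2 = q - 1" "(p - 1) / 2 = - q"
    by (simp_all add: p power2_eq_square field_simps)
  ultimately show ?thesis
    unfolding model_sol'_def[abs_def] model_sol_def model_coeff_def q_def[symmetric] \<theta>_def[symmetric] exponents
    by simp
qed

section \<open>Sturm comparison\<close>

text \<open>
  The hypothesis \<open>less\<close> says that the Wronskian \<open>u' w - u w'\<close> is strictly increasing, whereas its values
  at the two zeros of \<open>u\<close> are \<open>u' \<alpha> * w \<alpha> \<ge> 0\<close> and \<open>u' \<beta> * w \<beta> \<le> 0\<close>. The second derivatives are
  kept free of any equation, so that \<open>w\<close> may be a supersolution, and the roles of \<open>u\<close> and \<open>w\<close> may be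
  played by the given solution and the model in either order.
\<close>
lemma sturm_comparison:
  fixes u w :: "real \<Rightarrow> real"
  assumes "\<alpha> < \<beta>"
    and u: "\<And>t. t \<in> {\<alpha>..\<beta>} \<Longrightarrow> (u has_real_derivative u' t) (at t)"
           "\<And>t. t \<in> {\<alpha>..\<beta>} \<Longrightarrow> (u' has_real_derivative u'' t) (at t)"
    and w: "\<And>t. t \<in> {\<alpha>..\<beta>} \<Longrightarrow> (w has_real_derivative w' t) (at t)"
           "\<And>t. t \<in> {\<alpha>..\<beta>} \<Longrightarrow> (w' has_real_derivative w'' t) (at t)"
    and u_ends: "u \<alpha> = 0" "u \<beta> = 0" and u_pos: "\<And>t. t \<in> {\<alpha><..<\<beta>} \<Longrightarrow> u t > 0"
    and w_ends: "w \<alpha> \<ge> 0" "w \<beta> \<ge> 0"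
    and less: "\<And>t. t \<in> {\<alpha><..<\<beta>} \<Longrightarrow> u t * w'' t < u'' t * w t"
  shows False
proof -
  define W where "W t = u' t * w t - u t * w' t" for t
  have "W \<alpha> < W \<beta>"
  proof (rule DERIV_pos_imp_increasing_open[OF \<open>\<alpha> < \<beta>\<close>])
    fix t assume t: "\<alpha> < t" "t < \<beta>"
    then have "(W has_real_derivative u'' t * w t - u t * w'' t) (at t)"
      unfolding W_def using u[of t] w[of t] by (auto intro!: derivative_eq_intros simp: algebra_simps)
    then show "\<exists>y. (W has_real_derivative y) (at t) \<and> 0 < y"
      using less[of t] t by (intro exI[of _ "u'' t * w t - u t * w'' t"]) auto
  next
    show "continuous_on {\<alpha>..\<beta>} W"
      unfolding W_def
      by (intro continuous_intros continuous_at_imp_continuous_on ballI)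
         (blast intro: DERIV_isCont u w)+
  qed
  moreover have "u' \<alpha> \<ge> 0"
  proof (rule ccontr)
    assume "\<not> u' \<alpha> \<ge> 0"
    then obtain d where d: "d > 0" "\<And>h. 0 < h \<Longrightarrow> h < d \<Longrightarrow> u (\<alpha> + h) < u \<alpha>"
      using DERIV_neg_dec_right[OF u(1)[of \<alpha>]] \<open>\<alpha> < \<beta>\<close> by (auto simp: not_le)
    define h where "h = min d (\<beta> - \<alpha>) / 2"
    have "0 < h" "h < d" "\<alpha> + h < \<beta>" using d \<open>\<alpha> < \<beta>\<close> by (auto simp: h_def min_def field_simps)
    then show False using d(2)[of h] u_pos[of "\<alpha> + h"] u_ends by auto
  qed
  moreover have "u' \<beta> \<le> 0"
  proof (rule ccontr)
    assume "\<not> u' \<beta> \<le> 0"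
    then obtain d where d: "d > 0" "\<And>h. 0 < h \<Longrightarrow> h < d \<Longrightarrow> u (\<beta> - h) < u \<beta>"
      using DERIV_pos_inc_left[OF u(1)[of \<beta>]] \<open>\<alpha> < \<beta>\<close> by (auto simp: not_le)
    define h where "h = min d (\<beta> - \<alpha>) / 2"
    have "0 < h" "h < d" "\<alpha> < \<beta> - h" using d \<open>\<alpha> < \<beta>\<close> by (auto simp: h_def min_def field_simps)
    then show False using d(2)[of h] u_pos[of "\<beta> - h"] u_ends by auto
  qed
  ultimately show False
    using u_ends mult_nonneg_nonneg[OF _ w_ends(1), of "u' \<alpha>"] mult_nonpos_nonneg[OF _ w_ends(2), of "u' \<beta>"]
    by (auto simp: W_def)
qed

locale consecutive_zeros =
  fixes \<alpha> \<beta> :: real and y y' f :: "real \<Rightarrow> real"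
  assumes pos: "0 < \<alpha>" and less: "\<alpha> < \<beta>"
    and y: "t \<in> {\<alpha>..\<beta>} \<Longrightarrow> (y has_real_derivative y' t) (at t)"
    and y': "t \<in> {\<alpha>..\<beta>} \<Longrightarrow> (y' has_real_derivative - f t * y t) (at t)"
    and ends: "y \<alpha> = 0" "y \<beta> = 0"
    and nonzero: "t \<in> {\<alpha><..<\<beta>} \<Longrightarrow> y t \<noteq> 0"
begin

text \<open>A nonvanishing solution has constant sign, and the equation is invariant under \<open>y \<mapsto> - y\<close>.\<close>
lemma positive_solution:
  obtains u u' where
    "\<And>t. t \<in> {\<alpha>..\<beta>} \<Longrightarrow> (u has_real_derivative u' t) (at t)"
    "\<And>t. t \<in> {\<alpha>..\<beta>} \<Longrightarrow> (u' has_real_derivative - f t * u t) (at t)"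
    "u \<alpha> = 0" "u \<beta> = 0" "\<And>t. t \<in> {\<alpha><..<\<beta>} \<Longrightarrow> u t > 0"
proof -
  define m where "m = (\<alpha> + \<beta>) / 2"
  have m: "m \<in> {\<alpha><..<\<beta>}" using less by (auto simp: m_def)
  have same: "sgn (y t) = sgn (y m)" if t: "t \<in> {\<alpha><..<\<beta>}" for t
  proof (rule ccontr)
    assume ne: "sgn (y t) \<noteq> sgn (y m)"
    have "connected (y ` {\<alpha><..<\<beta>})"
      by (rule connected_continuous_image)
         (auto intro!: continuous_at_imp_continuous_on DERIV_isCont[OF y])
    moreover have "y t < 0 \<and> 0 < y m \<or> y m < 0 \<and> 0 < y t"
      using ne nonzero[OF t] nonzero[OF m] by (auto simp: sgn_if split: if_splits)
    ultimately have "0 \<in> y ` {\<alpha><..<\<beta>}"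
      using t m unfolding connected_iff_interval by (meson imageI less_imp_le)
    then show False using nonzero by auto
  qed
  show thesis
  proof (rule that[of "\<lambda>t. sgn (y m) * y t" "\<lambda>t. sgn (y m) * y' t"])
    fix t assume "t \<in> {\<alpha><..<\<beta>}"
    then show "sgn (y m) * y t > 0"
      using same[of t] nonzero[of t] by (auto simp: sgn_if split: if_splits)
  qed (use ends in \<open>auto intro!: derivative_eq_intros y y'\<close>)
qed

text \<open>
  If the gap were at most \<open>pi / b\<close> on the scale of \<open>power_log\<close>, the model solution that vanishes at
  \<open>\<alpha>\<close> would stay positive up to \<open>\<beta>\<close>, although it solves the equation with the larger coefficient and
  so has to vanish first.
\<close>
lemma spacing_gt:
  assumes b: "b > 0" and f: "\<And>t. t \<in> {\<alpha><..<\<beta>} \<Longrightarrow> f t < model_coeff p b t"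
  shows "b * (power_log p \<beta> - power_log p \<alpha>) > pi"
proof (rule ccontr)
  assume le: "\<not> ?thesis"
  obtain u u' where u: "\<And>t. t \<in> {\<alpha>..\<beta>} \<Longrightarrow> (u has_real_derivative u' t) (at t)"
    "\<And>t. t \<in> {\<alpha>..\<beta>} \<Longrightarrow> (u' has_real_derivative - f t * u t) (at t)"
    "u \<alpha> = 0" "u \<beta> = 0" "\<And>t. t \<in> {\<alpha><..<\<beta>} \<Longrightarrow> u t > 0"
    using positive_solution by blast
  have w: "model_sol p b \<alpha> t > 0" if "t \<in> {\<alpha><..<\<beta>}" for t
  proof -
    have "b * (power_log p t - power_log p \<alpha>) < b * (power_log p \<beta> - power_log p \<alpha>)"
      using that pos b power_log_strict_mono[of t \<beta> p] by auto
    moreover have "0 < b * (power_log p t - power_log p \<alpha>)"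
      using that pos b power_log_strict_mono[of \<alpha> t p] by auto
    ultimately show ?thesis
      using le that pos by (auto simp: model_sol_def intro!: mult_pos_pos sin_gt_zero)
  qed
  have "0 < b * (power_log p \<beta> - power_log p \<alpha>)"
    using less pos b power_log_strict_mono[of \<alpha> \<beta> p] by auto
  then have ends: "model_sol p b \<alpha> \<alpha> \<ge> 0" "model_sol p b \<alpha> \<beta> \<ge> 0"
    using le sin_ge_zero[of "b * (power_log p \<beta> - power_log p \<alpha>)"] by (auto simp: model_sol_def)
  show False
  proof (rule sturm_comparison[where w' = "model_sol' p b \<alpha>", OF less u(1,2) _ _ u(3-5) ends])
    fix t assume t: "t \<in> {\<alpha><..<\<beta>}"
    then show "u t * (- model_coeff p b t * model_sol p b \<alpha> t) < - f t * u t * model_sol p b \<alpha> t"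
      using f[OF t] mult_strict_right_mono[OF f[OF t] mult_pos_pos[OF u(5)[OF t] w[OF t]]]
      by (simp add: algebra_simps)
  qed (use pos DERIV_model_sol DERIV_model_sol' in auto)
qed

text \<open>
  The roles are exchanged: if the gap were at least \<open>pi / b\<close>, two zeros \<open>\<alpha> < \<gamma>\<close> of the model solution
  would enclose an interval on which the given solution, which has the larger coefficient, is positive.
\<close>
lemma spacing_lt:
  assumes b: "b > 0" and f: "\<And>t. t \<in> {\<alpha><..<\<beta>} \<Longrightarrow> model_coeff p b t < f t"
  shows "b * (power_log p \<beta> - power_log p \<alpha>) < pi"
proof (rule ccontr)
  assume le: "\<not> ?thesis"
  obtain u u' where u: "\<And>t. t \<in> {\<alpha>..\<beta>} \<Longrightarrow> (u has_real_derivative u' t) (at t)"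
    "\<And>t. t \<in> {\<alpha>..\<beta>} \<Longrightarrow> (u' has_real_derivative - f t * u t) (at t)"
    "u \<alpha> = 0" "u \<beta> = 0" "\<And>t. t \<in> {\<alpha><..<\<beta>} \<Longrightarrow> u t > 0"
    using positive_solution by blast
  have "\<exists>\<gamma>\<ge>\<alpha>. \<gamma> \<le> \<beta> \<and> b * (power_log p \<gamma> - power_log p \<alpha>) = pi"
    using le less pos
    by (intro IVT') (auto intro!: continuous_at_imp_continuous_on continuous_mult continuous_diff continuous_const DERIV_isCont[OF DERIV_power_log])
  then obtain \<gamma> where \<gamma>: "\<alpha> \<le> \<gamma>" "\<gamma> \<le> \<beta>" "b * (power_log p \<gamma> - power_log p \<alpha>) = pi" by blast
  then have "\<alpha> < \<gamma>" by (cases "\<alpha> = \<gamma>") auto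
  have w: "model_sol p b \<alpha> t > 0" if "t \<in> {\<alpha><..<\<gamma>}" for t
  proof -
    have "b * (power_log p t - power_log p \<alpha>) < b * (power_log p \<gamma> - power_log p \<alpha>)"
      using that pos b power_log_strict_mono[of t \<gamma> p] by auto
    moreover have "0 < b * (power_log p t - power_log p \<alpha>)"
      using that pos b power_log_strict_mono[of \<alpha> t p] by auto
    ultimately show ?thesis
      using \<gamma> that pos by (auto simp: model_sol_def intro!: mult_pos_pos sin_gt_zero)
  qed
  have ends: "model_sol p b \<alpha> \<alpha> = 0" "model_sol p b \<alpha> \<gamma> = 0"
    using \<gamma> by (auto simp: model_sol_def)
  show False
  proof (rule sturm_comparison[where u' = "model_sol' p b \<alpha>", OF \<open>\<alpha> < \<gamma>\<close> _ _ u(1,2) ends w])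
    fix t assume t: "t \<in> {\<alpha><..<\<gamma>}"
    then have "t \<in> {\<alpha><..<\<beta>}" using \<gamma> by auto
    from mult_strict_right_mono[OF f[OF this] mult_pos_pos[OF u(5)[OF this] w[OF t]]]
    show "model_sol p b \<alpha> t * (- f t * u t) < - model_coeff p b t * model_sol p b \<alpha> t * u t"
      by (simp add: algebra_simps)
  next
    show "0 \<le> u \<alpha>" "0 \<le> u \<gamma>"
      using u(3,4) u(5)[of \<gamma>] \<gamma>(1,2) \<open>\<alpha> < \<gamma>\<close> by (cases "\<gamma> = \<beta>"; force)+
  qed (use pos \<gamma> DERIV_model_sol DERIV_model_sol' in auto)
qed

text \<open>
  The function \<open>w t = sqrt t - K / sqrt t\<close> is positive for \<open>t > K\<close>, and with the maximal coefficient
  admitted here \<open>w'' + f w = - K\<^sup>2 t powr (- 7 / 2)\<close>. The first-order correction \<open>- K / sqrt t\<close> to the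
  solution \<open>sqrt t\<close> of the critical equation \<open>w'' + w / (4 t\<^sup>2) = 0\<close> is chosen to absorb the
  perturbation \<open>K / t\<^sup>3\<close>.
\<close>
lemma not_below_critical:
  assumes K: "0 < K" "K < \<alpha>"
    and f: "\<And>t. t \<in> {\<alpha><..<\<beta>} \<Longrightarrow> f t \<le> 1 / (4 * t\<^sup>2) + K / t ^ 3"
  shows False
proof -
  obtain u u' where u: "\<And>t. t \<in> {\<alpha>..\<beta>} \<Longrightarrow> (u has_real_derivative u' t) (at t)"
    "\<And>t. t \<in> {\<alpha>..\<beta>} \<Longrightarrow> (u' has_real_derivative - f t * u t) (at t)"
    "u \<alpha> = 0" "u \<beta> = 0" "\<And>t. t \<in> {\<alpha><..<\<beta>} \<Longrightarrow> u t > 0"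
    using positive_solution by blast
  define w where "w t = t powr (1 / 2) - K * t powr (- 1/2)" for t
  define dw where "dw t = t powr (- 1/2) / 2 + K / 2 * t powr (- 3/2)" for t
  define ddw where "ddw t = - (t powr (- 3/2) / 4) - 3 / 4 * K * t powr (- 5/2)" for t
  have w_eq: "w t = t powr (- 1/2) * (t - K)" "ddw t = - (t powr (- 1/2) * (1 / (4 * t) + 3 / 4 * K / t\<^sup>2))"
    if "t > 0" for t
  proof -
    have "t powr (1 / 2) = t powr (- 1/2) * t" "t powr (- 3/2) = t powr (- 1/2) / t"
      "t powr (- 5/2) = t powr (- 1/2) / t\<^sup>2"
      using that powr_add[of t "- 1/2" 1] powr_diff[of t "- 1/2" 1] powr_diff[of t "- 1/2" 2] by simp_all
    then show "w t = t powr (- 1/2) * (t - K)" "ddw t = - (t powr (- 1/2) * (1 / (4 * t) + 3 / 4 * K / t\<^sup>2))"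
      by (simp_all add: w_def ddw_def algebra_simps)
  qed
  show False
  proof (rule sturm_comparison[OF less u(1,2) _ _ u(3-5)])
    fix t assume "t \<in> {\<alpha>..\<beta>}"
    then have t: "t > 0" using pos by auto
    show "(w has_real_derivative dw t) (at t)"
      using t unfolding w_def[abs_def] dw_def
      by (auto intro!: derivative_eq_intros has_real_derivative_powr)
    show "(dw has_real_derivative ddw t) (at t)"
      using t unfolding dw_def[abs_def] ddw_def
      by (auto intro!: derivative_eq_intros has_real_derivative_powr)
  next
    fix t assume t: "t \<in> {\<alpha><..<\<beta>}"
    then have t0: "t > K" "t > 0" using K by auto
    have "f t * (t - K) \<le> (1 / (4 * t\<^sup>2) + K / t ^ 3) * (t - K)"
      using f[OF t] t0 by (intro mult_right_mono) auto
    also have "\<dots> = 1 / (4 * t) + 3 / 4 * K / t\<^sup>2 - K\<^sup>2 / t ^ 3"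
      using t0 by (simp add: field_simps power2_eq_square power3_eq_cube)
    also have "\<dots> < 1 / (4 * t) + 3 / 4 * K / t\<^sup>2"
      using K t0 by simp
    finally have "(u t * t powr (- 1/2)) * (f t * (t - K)) < (u t * t powr (- 1/2)) * (1 / (4 * t) + 3 / 4 * K / t\<^sup>2)"
      using u(5)[OF t] t0 by (intro mult_strict_left_mono) auto
    then show "u t * ddw t < - f t * u t * w t"
      unfolding w_eq[OF t0(2)] by (simp add: algebra_simps)
  next
    show "0 \<le> w \<alpha>" "0 \<le> w \<beta>" using K pos less by (auto simp: w_eq)
  qed
qed

end

section \<open>Asymptotic spacing of the zeros\<close>

text \<open>
  The hypothesis on \<open>f\<close> compares it with \<open>model_coeff p b\<close>: the function that tends to \<open>\<kappa>\<close> would be the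
  constant \<open>b\<^sup>2\<close> for \<open>f = model_coeff p b\<close>. So every \<open>b\<close> with \<open>b\<^sup>2 \<noteq> \<kappa>\<close> bounds the gaps eventually,
  from below or from above.
\<close>
lemma spacing_tendsto:
  assumes zeros: "\<forall>\<^sub>F n in sequentially. consecutive_zeros (s n) (s (Suc n)) y y' f"
    and s: "filterlim s at_top sequentially"
    and "\<kappa> > 0"
    and f: "((\<lambda>t. (f t - (1 - p\<^sup>2) / 4 * t powr - 2) * t powr (2 - 2 * p)) \<longlongrightarrow> \<kappa>) at_top"
  shows "(\<lambda>n. power_log p (s (Suc n)) - power_log p (s n)) \<longlonglongrightarrow> pi / sqrt \<kappa>"
proof -
  have expand: "f t = (f t - (1 - p\<^sup>2) / 4 * t powr - 2) * t powr (2 - 2 * p) * t powr (2 * p - 2)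
      + (1 - p\<^sup>2) / 4 * t powr - 2" if "t > 0" for t
    using that by (simp add: mult.assoc flip: powr_add)
  have from_s: "\<forall>\<^sub>F n in sequentially. \<forall>t \<in> {s n<..<s (Suc n)}. P t" if "eventually P at_top" for P
  proof -
    from that obtain T where T: "\<And>t. t \<ge> T \<Longrightarrow> P t"
      unfolding eventually_at_top_linorder by blast
    have "\<forall>\<^sub>F n in sequentially. s n \<ge> T"
      using s by (simp add: filterlim_at_top)
    then show ?thesis by eventually_elim (auto intro: T)
  qed
  have gt: "\<forall>\<^sub>F n in sequentially. power_log p (s (Suc n)) - power_log p (s n) > pi / b"
    if b: "b > sqrt \<kappa>" for b
  proof -
    have b0: "b > 0" using b \<open>\<kappa> > 0\<close> by (meson less_trans real_sqrt_gt_zero)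
    have "b\<^sup>2 > \<kappa>" using power_strict_mono[OF b, of 2] \<open>\<kappa> > 0\<close> by simp
    from order_tendstoD(2)[OF f this]
    have "\<forall>\<^sub>F t in at_top. f t < model_coeff p b t"
      using eventually_gt_at_top[of 0]
    proof eventually_elim
      case (elim t)
      show ?case
        unfolding model_coeff_def using elim by (subst expand) (auto intro!: mult_strict_right_mono)
    qed
    from from_s[OF this] zeros show ?thesis
    proof eventually_elim
      case (elim n)
      then show ?case
        using consecutive_zeros.spacing_gt[of "s n" "s (Suc n)" y y' f b p] b0
        by (simp add: field_simps)
    qed
  qed
  have lt: "\<forall>\<^sub>F n in sequentially. power_log p (s (Suc n)) - power_log p (s n) < pi / b"
    if b: "0 < b" "b < sqrt \<kappa>" for b
  proof -
    have "b\<^sup>2 < \<kappa>" using power_strict_mono[OF b(2), of 2] b \<open>\<kappa> > 0\<close> by simp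
    from order_tendstoD(1)[OF f this]
    have "\<forall>\<^sub>F t in at_top. model_coeff p b t < f t"
      using eventually_gt_at_top[of 0]
    proof eventually_elim
      case (elim t)
      show ?case
        unfolding model_coeff_def using elim by (subst expand) (auto intro!: mult_strict_right_mono)
    qed
    from from_s[OF this] zeros show ?thesis
    proof eventually_elim
      case (elim n)
      then show ?case
        using consecutive_zeros.spacing_lt[of "s n" "s (Suc n)" y y' f b p] b
        by (simp add: field_simps)
    qed
  qed
  have l: "pi / sqrt \<kappa> > 0" using \<open>\<kappa> > 0\<close> by simp
  show ?thesis
  proof (rule order_tendstoI)
    fix a assume a: "a < pi / sqrt \<kappa>"
    (* A positive bound m \<ge> a is the spacing pi / b of a model equation; a itself may be negative. *)
    define m where "m = max a (pi / sqrt \<kappa> / 2)"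
    have m: "0 < m" "m < pi / sqrt \<kappa>" "a \<le> m" using a l by (auto simp: m_def)
    have "sqrt \<kappa> < pi / m" using m \<open>\<kappa> > 0\<close> by (simp add: field_simps)
    from gt[OF this] show "\<forall>\<^sub>F n in sequentially. a < power_log p (s (Suc n)) - power_log p (s n)"
      by eventually_elim (use m in auto)
  next
    fix a assume a: "pi / sqrt \<kappa> < a"
    then have "a > 0" using l by linarith
    then have "pi / a < sqrt \<kappa>" "pi / a > 0" using a \<open>\<kappa> > 0\<close> by (simp_all add: field_simps)
    from lt[OF this(2,1)] show "\<forall>\<^sub>F n in sequentially. power_log p (s (Suc n)) - power_log p (s n) < a"
      using \<open>a > 0\<close> by simp
  qed
qed

text \<open>
  The Stolz--Cesaro argument: up to an additive constant, \<open>x n - l * n\<close> is a sum of at most \<open>n\<close> terms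
  that are all eventually smaller than \<open>\<epsilon> / 2\<close>.
\<close>
lemma increments_tendsto_imp_ratio_tendsto:
  fixes x :: "nat \<Rightarrow> real"
  assumes "(\<lambda>n. x (Suc n) - x n) \<longlonglongrightarrow> l"
  shows "(\<lambda>n. x n / real n) \<longlonglongrightarrow> l"
proof (rule LIMSEQ_I)
  fix \<epsilon> :: real assume "\<epsilon> > 0"
  obtain N where N: "\<And>n. n \<ge> N \<Longrightarrow> \<bar>x (Suc n) - x n - l\<bar> < \<epsilon> / 2"
    using LIMSEQ_D[OF assms, of "\<epsilon> / 2"] \<open>\<epsilon> > 0\<close> by auto
  have bound: "\<bar>x n - l * n\<bar> \<le> \<bar>x N - l * N\<bar> + \<epsilon> / 2 * n" if "n \<ge> N" for n
    using that
  proof (induction n rule: dec_induct)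
    case base
    then show ?case using \<open>\<epsilon> > 0\<close> by simp
  next
    case (step n)
    have "x (Suc n) - l * Suc n = (x n - l * n) + (x (Suc n) - x n - l)"
      by (simp add: algebra_simps)
    then have "\<bar>x (Suc n) - l * Suc n\<bar> \<le> \<bar>x n - l * n\<bar> + \<bar>x (Suc n) - x n - l\<bar>"
      by (metis abs_triangle_ineq)
    also have "\<dots> \<le> (\<bar>x N - l * N\<bar> + \<epsilon> / 2 * n) + \<epsilon> / 2"
      using step N[of n] by (intro add_mono) auto
    finally show ?case by (simp add: field_simps)
  qed
  obtain M :: nat where M: "\<bar>x N - l * N\<bar> / (\<epsilon> / 2) < M"
    using reals_Archimedean2 by blast
  show "\<exists>n0. \<forall>n\<ge>n0. norm (x n / real n - l) < \<epsilon>"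
  proof (intro exI allI impI)
    fix n assume n: "n \<ge> max 1 (max N M)"
    then have "real M \<le> n" by simp
    have "\<bar>x N - l * N\<bar> < \<epsilon> / 2 * n"
      using less_le_trans[OF M \<open>real M \<le> n\<close>] \<open>\<epsilon> > 0\<close> by (simp add: field_simps)
    then have "\<bar>x n - l * n\<bar> < \<epsilon> * n" using bound[of n] n by (simp add: algebra_simps)
    moreover have "x n / n - l = (x n - l * n) / n" using n by (simp add: field_simps)
    ultimately show "norm (x n / real n - l) < \<epsilon>"
      using n by (simp add: field_simps)
  qed
qed

section \<open>Rational functions near the critical coefficient\<close>

lemma poly_divide_convergent:
  fixes p q :: "'a :: real_normed_field poly"
  assumes "degree p \<le> degree q" "q \<noteq> 0"
  obtains l where "((\<lambda>x. poly p x / poly q x) \<longlongrightarrow> l) at_infinity"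
proof (cases "degree p < degree q")
  case True
  then show thesis by (rule that[OF poly_divide_tendsto_0_at_infinity])
next
  case False
  then have deg: "degree p = degree q" using assms by simp
  have "((\<lambda>x. (poly p x / x ^ degree p) / (poly q x / x ^ degree q)) \<longlongrightarrow> lead_coeff p / lead_coeff q) at_infinity"
    using assms by (intro tendsto_divide poly_divide_tendsto_aux) auto
  moreover have "\<forall>\<^sub>F x :: 'a in at_infinity.
      (poly p x / x ^ degree p) / (poly q x / x ^ degree q) = poly p x / poly q x"
  proof (rule eventually_at_infinityI[of 1])
    fix x :: 'a assume "1 \<le> norm x"
    then have "x \<noteq> 0" by auto
    then show "(poly p x / x ^ degree p) / (poly q x / x ^ degree q) = poly p x / poly q x"
      by (simp add: deg)
  qed
  ultimately show thesis by (rule that[OF Lim_transform_eventually])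
qed

text \<open>
  A rational function that vanishes at infinity has a numerator of smaller degree than its denominator,
  and multiplication by \<open>x\<close> raises the degree by one only. This gap in the possible rates of decay is
  what makes rationality of the coefficient useful in the critical case.
\<close>
lemma poly_divide_tendsto_0_imp_times_convergent:
  fixes p q :: "real poly"
  assumes lim: "((\<lambda>x. poly p x / poly q x) \<longlongrightarrow> 0) at_top" and "q \<noteq> 0"
  obtains l where "((\<lambda>x. x * (poly p x / poly q x)) \<longlongrightarrow> l) at_top"
proof (cases "p = 0")
  case True
  then show thesis by (intro that[of 0]) auto
next
  case False
  have nz: "\<forall>\<^sub>F x in at_top. poly r x \<noteq> 0" if "r \<noteq> 0" for r :: "real poly"
    using poly_eventually_not_zero[OF that] at_top_le_at_infinity by (rule filter_leD[rotated])
  have "degree p < degree q"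
  proof (rule ccontr)
    assume "\<not> degree p < degree q"
    then obtain l where "((\<lambda>x. poly q x / poly p x) \<longlongrightarrow> l) at_infinity"
      using poly_divide_convergent[of q p] False by (auto simp: not_less)
    then have "((\<lambda>x. poly q x / poly p x) \<longlongrightarrow> l) at_top"
      by (rule tendsto_mono[OF at_top_le_at_infinity])
    from tendsto_mult[OF lim this]
    have "((\<lambda>x. poly p x / poly q x * (poly q x / poly p x)) \<longlongrightarrow> 0) at_top" by simp
    moreover have "\<forall>\<^sub>F x in at_top. poly p x / poly q x * (poly q x / poly p x) = 1"
      using nz[OF False] nz[OF \<open>q \<noteq> 0\<close>] by eventually_elim simp
    ultimately have "((\<lambda>_. 1 :: real) \<longlongrightarrow> 0) (at_top :: real filter)"
      by (rule Lim_transform_eventually)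
    then show False
      using tendsto_unique[OF _ tendsto_const, of "at_top :: real filter" "1 :: real" 0] by simp
  qed
  then have "degree (pCons 0 p) \<le> degree q" using False by simp
  then obtain l where "((\<lambda>x. poly (pCons 0 p) x / poly q x) \<longlongrightarrow> l) at_infinity"
    using poly_divide_convergent[of "pCons 0 p" q] \<open>q \<noteq> 0\<close> by blast
  then have "((\<lambda>x. poly (pCons 0 p) x / poly q x) \<longlongrightarrow> l) at_top"
    by (rule tendsto_mono[OF at_top_le_at_infinity])
  then show thesis by (intro that[of l]) simp
qed

lemma rational_le_critical:
  assumes "germ_of f \<in> rational_germs"
    and f: "((\<lambda>t. t\<^sup>2 * f t) \<longlongrightarrow> c) at_top" and "c \<le> 1 / 4"
  obtains K where "K > 0" "\<forall>\<^sub>F t in at_top. f t \<le> 1 / (4 * t\<^sup>2) + K / t ^ 3"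
proof -
  have "\<exists>K>0. \<forall>\<^sub>F t in at_top. t * (t\<^sup>2 * f t - 1 / 4) < K"
  proof (cases "c < 1 / 4")
    case True
    from order_tendstoD(2)[OF f True] eventually_gt_at_top[of 0]
    have "\<forall>\<^sub>F t in at_top. t * (t\<^sup>2 * f t - 1 / 4) < 1"
    proof eventually_elim
      case (elim t)
      then show ?case using mult_pos_neg[of t "t\<^sup>2 * f t - 1 / 4"] by simp
    qed
    then show ?thesis by (intro exI[of _ 1]) auto
  next
    case False
    with \<open>c \<le> 1 / 4\<close> have "c = 1 / 4" by simp
    obtain p q :: "real poly" where q: "q \<noteq> 0" and pq: "germ_of f = germ_of (\<lambda>t. poly p t / poly q t)"
      using assms(1) by (auto simp: rational_germs_def)
    from pq have ev: "\<forall>\<^sub>F t in at_top. f t = poly p t / poly q t"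
      by (simp add: germ.abs_eq_iff eventually_eq_def)
    have nz: "\<forall>\<^sub>F t in at_top. poly q t \<noteq> 0"
      using poly_eventually_not_zero[OF q] at_top_le_at_infinity by (rule filter_leD[rotated])
    define P where "P = monom 4 2 * p - q"
    define Q where "Q = smult 4 q"
    have eq: "\<forall>\<^sub>F t in at_top. t\<^sup>2 * f t - 1 / 4 = poly P t / poly Q t"
      using ev nz by eventually_elim (simp add: P_def Q_def poly_monom field_simps)
    have "((\<lambda>t. t\<^sup>2 * f t - 1 / 4) \<longlongrightarrow> 0) at_top"
      using tendsto_diff[OF f tendsto_const[of c]] \<open>c = 1 / 4\<close> by simp
    then have "((\<lambda>t. poly P t / poly Q t) \<longlongrightarrow> 0) at_top"
      using eq by (rule Lim_transform_eventually)
    then obtain l where l: "((\<lambda>t. t * (poly P t / poly Q t)) \<longlongrightarrow> l) at_top"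
      using poly_divide_tendsto_0_imp_times_convergent[of P Q] q by (auto simp: Q_def)
    have "l < \<bar>l\<bar> + 1" by linarith
    from order_tendstoD(2)[OF l this] eq
    have "\<forall>\<^sub>F t in at_top. t * (t\<^sup>2 * f t - 1 / 4) < \<bar>l\<bar> + 1"
      by eventually_elim simp
    then show ?thesis by (intro exI[of _ "\<bar>l\<bar> + 1"]) auto
  qed
  then obtain K where K: "K > 0" "\<forall>\<^sub>F t in at_top. t * (t\<^sup>2 * f t - 1 / 4) < K" by blast
  from K(2) eventually_gt_at_top[of 0] have "\<forall>\<^sub>F t in at_top. f t \<le> 1 / (4 * t\<^sup>2) + K / t ^ 3"
  proof eventually_elim
    case (elim t)
    have "f t = (t * (t\<^sup>2 * f t - 1 / 4)) / t ^ 3 + 1 / (4 * t\<^sup>2)"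
      using elim by (simp add: field_simps power2_eq_square power3_eq_cube)
    also have "\<dots> \<le> K / t ^ 3 + 1 / (4 * t\<^sup>2)"
      using elim by (intro add_right_mono divide_right_mono) auto
    finally show ?case by simp
  qed
  with K(1) that show thesis by blast
qed

section \<open>The zeros of an oscillating solution\<close>

theorem corollary5:
  fixes f y y' y'' :: "real \<Rightarrow> real" and s :: "nat \<Rightarrow> real" and e c r :: real
  assumes f_cont: "continuous_on {e..} f"
    and f_hardian: "hardian (germ_of f)"
    and f_nonzero: "\<And>t. t \<ge> e \<Longrightarrow> f t \<noteq> 0"
    and y_deriv: "\<And>t. t \<ge> e \<Longrightarrow> (y has_real_derivative y' t) (at t within {e..})"
    and y'_deriv: "\<And>t. t \<ge> e \<Longrightarrow> (y' has_real_derivative y'' t) (at t within {e..})"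
    and y''_cont: "continuous_on {e..} y''"
    and y_oscillates: "oscillates y"
    and ode: "\<And>t. t \<ge> e \<Longrightarrow> y'' t + f t * y t = 0"
    and s_strict_mono: "strict_mono s"
    and s_range: "range s = {t. t \<ge> e \<and> y t = 0}"
    and f_asymp: "f \<sim>[at_top] (\<lambda>t. c * t powr (-2 + r))"
    and c_pos: "c > 0"
    and r_nonneg: "r \<ge> 0"
  shows "(r > 0 \<longrightarrow> s \<sim>[at_top] (\<lambda>n. (r * pi * real n / (2 * sqrt c)) powr (2 / r))) \<and>
         (r = 0 \<and> germ_of f \<in> rational_germs \<longrightarrow>
            c > 1 / 4 \<and> (\<lambda>n. ln (s n)) \<sim>[at_top] (\<lambda>n. pi * real n / sqrt (c - 1 / 4)))"
proof -
  have s_zero: "s n \<ge> e" "y (s n) = 0" for n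
    using s_range by auto
  have s_top: "filterlim s at_top sequentially"
    unfolding filterlim_at_top
  proof
    fix Z
    have "\<exists>\<^sub>F t in at_top. y t = 0" using y_oscillates by (simp add: oscillates_def)
    then obtain t where t: "t \<ge> max Z e" "y t = 0"
      unfolding frequently_def eventually_at_top_linorder by blast
    then have "t \<in> range s" using s_range by simp
    then obtain m where m: "s m = t" by blast
    have "Z \<le> s n" if "n \<ge> m" for n
      using monoD[OF strict_mono_mono[OF s_strict_mono] that] m t by simp
    then show "\<forall>\<^sub>F n in sequentially. Z \<le> s n" by (rule eventually_sequentiallyI)
  qed
  have s_pos: "\<forall>\<^sub>F n in sequentially. s n > 0"
    using s_top by (simp add: filterlim_at_top_dense)
  have zeros: "\<forall>\<^sub>F n in sequentially. consecutive_zeros (s n) (s (Suc n)) y y' f"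
    using s_pos eventually_gt_at_top[of 0]
  proof eventually_elim
    case (elim n)
    have "e < s n" using s_zero(1)[of 0] strict_monoD[OF s_strict_mono elim(2)] by simp
    have within: "at t within {e..} = at t" if "t \<ge> s n" for t
      using that \<open>e < s n\<close> by (intro at_within_interior) (simp add: interior_real_atLeast)
    show ?case
    proof
      fix t assume t: "t \<in> {s n..s (Suc n)}"
      then show "(y has_real_derivative y' t) (at t)"
        using y_deriv[of t] within[of t] \<open>e < s n\<close> by simp
      have "y'' t = - f t * y t" using ode[of t] t \<open>e < s n\<close> by simp
      then show "(y' has_real_derivative - f t * y t) (at t)"
        using y'_deriv[of t] within[of t] t \<open>e < s n\<close> by simp
    next
      fix t assume t: "t \<in> {s n<..<s (Suc n)}"
      show "y t \<noteq> 0"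
      proof
        assume "y t = 0"
        then have "t \<in> range s" using s_range t \<open>e < s n\<close> by simp
        then obtain m where "t = s m" by blast
        then show False using t strict_mono_less[OF s_strict_mono] by auto
      qed
    qed (use elim s_zero strict_monoD[OF s_strict_mono] in auto)
  qed
  have f_lim: "((\<lambda>t. f t * t powr (2 - r)) \<longlongrightarrow> c) at_top"
  proof -
    have "\<forall>\<^sub>F t in at_top. f t \<noteq> 0 \<or> c * t powr (-2 + r) \<noteq> 0"
      using eventually_gt_at_top[of 0] by eventually_elim (use c_pos in auto)
    from tendsto_mult_left[OF asymp_equivD_strong[OF f_asymp this], of c]
    have "((\<lambda>t. c * (f t / (c * t powr (-2 + r)))) \<longlongrightarrow> c) at_top" by simp
    moreover have "\<forall>\<^sub>F t in at_top. c * (f t / (c * t powr (-2 + r))) = f t * t powr (2 - r)"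
      using eventually_gt_at_top[of 0]
    proof eventually_elim
      case (elim t)
      have "t powr (2 - r) = 1 / t powr (-2 + r)"
        using powr_minus_divide[of t "-2 + r"] by simp
      then show ?case using c_pos by simp
    qed
    ultimately show ?thesis by (rule Lim_transform_eventually)
  qed
  (* \<kappa> is the limit of f(t) t^(2 - r) minus the contribution (1 - (r/2)^2)/4 t^(-r) of the Schwarzian
     term, which vanishes in the limit for r > 0 and is constantly 1/4 for r = 0. *)
  have ratio: "(\<lambda>n. power_log (r / 2) (s n) / real n) \<longlonglongrightarrow> pi / sqrt \<kappa>"
    if "\<kappa> > 0" and "((\<lambda>t. (1 - (r / 2)\<^sup>2) / 4 * t powr - r) \<longlongrightarrow> c - \<kappa>) at_top" for \<kappa>
  proof (intro increments_tendsto_imp_ratio_tendsto spacing_tendsto[OF zeros s_top \<open>\<kappa> > 0\<close>])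
    have "((\<lambda>t. f t * t powr (2 - r) - (1 - (r / 2)\<^sup>2) / 4 * t powr - r) \<longlongrightarrow> \<kappa>) at_top"
      using tendsto_diff[OF f_lim that(2)] by simp
    moreover have "f t * t powr (2 - r) - (1 - (r / 2)\<^sup>2) / 4 * t powr - r
       = (f t - (1 - (r / 2)\<^sup>2) / 4 * t powr - 2) * t powr (2 - 2 * (r / 2))" for t
      by (simp add: left_diff_distrib flip: powr_add)
    ultimately show "((\<lambda>t. (f t - (1 - (r / 2)\<^sup>2) / 4 * t powr - 2) * t powr (2 - 2 * (r / 2))) \<longlongrightarrow> \<kappa>) at_top"
      by simp
  qed
  show ?thesis
  proof (intro conjI impI; (elim conjE)?)
    assume "r > 0"
    have "((\<lambda>t. (1 - (r / 2)\<^sup>2) / 4 * t powr - r) \<longlongrightarrow> c - c) at_top"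
      unfolding diff_self
      by (intro tendsto_mult_right_zero tendsto_neg_powr filterlim_ident) (simp add: \<open>r > 0\<close>)
    from ratio[OF c_pos this] have "(\<lambda>n. power_log (r / 2) (s n)) \<sim>[at_top] (\<lambda>n. pi / sqrt c * real n)"
      using c_pos by (intro asymp_equivI'_const) auto
    then have "(\<lambda>n. r / 2 * power_log (r / 2) (s n)) \<sim>[at_top] (\<lambda>n. r / 2 * (pi / sqrt c * real n))"
      by (intro asymp_equiv_intros)
    then have "(\<lambda>n. (r / 2 * power_log (r / 2) (s n)) powr (2 / r)) \<sim>[at_top]
        (\<lambda>n. (r / 2 * (pi / sqrt c * real n)) powr (2 / r))"
      by (rule asymp_equiv_powr_real) (use \<open>r > 0\<close> c_pos in \<open>auto simp: power_log_def\<close>)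
    moreover have "\<forall>\<^sub>F n in sequentially. (r / 2 * power_log (r / 2) (s n)) powr (2 / r) = s n"
      using s_pos by eventually_elim (use \<open>r > 0\<close> in \<open>simp add: power_log_def powr_powr\<close>)
    ultimately show "s \<sim>[at_top] (\<lambda>n. (r * pi * real n / (2 * sqrt c)) powr (2 / r))"
      by (rule asymp_equiv_transfer) (simp add: field_simps)
  next
    assume "r = 0" and rational: "germ_of f \<in> rational_germs"
    show c: "c > 1 / 4"
    proof (rule ccontr)
      assume "\<not> c > 1 / 4"
      have "\<forall>\<^sub>F t in at_top. f t * t powr (2 - r) = t\<^sup>2 * f t"
        using eventually_gt_at_top[of 0] by eventually_elim (simp add: \<open>r = 0\<close>)
      with f_lim have "((\<lambda>t. t\<^sup>2 * f t) \<longlongrightarrow> c) at_top"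
        by (rule Lim_transform_eventually)
      then obtain K where K: "K > 0" "\<forall>\<^sub>F t in at_top. f t \<le> 1 / (4 * t\<^sup>2) + K / t ^ 3"
        using rational_le_critical[OF rational] \<open>\<not> c > 1 / 4\<close> by (auto simp: not_less)
      then obtain T where T: "\<And>t. t \<ge> T \<Longrightarrow> f t \<le> 1 / (4 * t\<^sup>2) + K / t ^ 3"
        unfolding eventually_at_top_linorder by blast
      have "\<forall>\<^sub>F n in sequentially. s n > max K T"
        using s_top unfolding filterlim_at_top_dense by blast
      with zeros have "\<forall>\<^sub>F n in sequentially. False"
        by eventually_elim (rule consecutive_zeros.not_below_critical[OF _ K(1)], auto intro: T)
      then show False by simp
    qed
    have "((\<lambda>t. (1 - (r / 2)\<^sup>2) / 4 * t powr - r) \<longlongrightarrow> c - (c - 1 / 4)) at_top"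
    proof (rule tendsto_eventually)
      show "\<forall>\<^sub>F t in at_top. (1 - (r / 2)\<^sup>2) / 4 * t powr - r = c - (c - 1 / 4)"
        using eventually_gt_at_top[of 0] by eventually_elim (simp add: \<open>r = 0\<close>)
    qed
    from ratio[OF _ this] c have "(\<lambda>n. ln (s n) / real n) \<longlonglongrightarrow> pi / sqrt (c - 1 / 4)"
      by (simp add: \<open>r = 0\<close> power_log_def)
    then have "(\<lambda>n. ln (s n)) \<sim>[at_top] (\<lambda>n. pi / sqrt (c - 1 / 4) * real n)"
      using c by (intro asymp_equivI'_const) auto
    then show "(\<lambda>n. ln (s n)) \<sim>[at_top] (\<lambda>n. pi * real n / sqrt (c - 1 / 4))"
      by simp
  qed
qed

end
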